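(* Let $ABCD$ be a convex Hjelmslev quadrilateral and let $E$ be its Poncelet point. Let $F$, $G$, $H$, and $I$ be the de Longchamps points ($X_{20}$ points) of $\triangle EAB$, $\triangle EBC$, $\triangle ECD$, and $\triangle EDA$, respectively. Then $$[ABCD]=\frac12[FGHI].$$
   Context: A Hjelmslev quadrilateral is a quadrilateral with right angles at two opposite vertices. The Poncelet point of a quadrilateral $ABCD$ is the common point of the nine-point circles of its four component triangles $BCD$, $ACD$, $ABD$, $ABC$; the nine-point circle of a triangle is the circle through the midpoints of its sides. The $X_{20}$ point (de Longchamps point) of a triangle is the reflection of its orthocenter in its circumcenter; equivalently, in a triangle with side lengths $a,b,c$ (opposite the vertices $A,B,C$) it has barycentric coordinates $(g(a,b,c):g(b,c,a):g(c,a,b))$ with $g(a,b,c)=3a^4-2a^2b^2-2a^2c^2-b^4+2b^2c^2-c^4$. $[XYZW]$ denotes the signed area of the (possibly non-convex or self-intersecting) quadrilateral $XYZW$, defined by $[XYZW]=[XYZ]+[ZWX]$ with signed areas of triangles (orientation taken positive for the orientation of $ABCD$). *)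

theory Defs
  imports "HOL-Analysis.Analysis"
begin

text \<open>A convex quadrilateral is given by its vertices in cyclic order: it is nondegenerate
  and its diagonals cross in their interiors.\<close>

definition convex_quadrilateral :: "real^2 \<Rightarrow> real^2 \<Rightarrow> real^2 \<Rightarrow> real^2 \<Rightarrow> bool" where
  "convex_quadrilateral A B C D \<longleftrightarrow>
     \<not> collinear {A, B, C} \<and> \<not> collinear {B, C, D} \<and>
     \<not> collinear {C, D, A} \<and> \<not> collinear {D, A, B} \<and>
     open_segment A C \<inter> open_segment B D \<noteq> {}"

definition right_angle :: "real^2 \<Rightarrow> real^2 \<Rightarrow> real^2 \<Rightarrow> bool" where
  "right_angle P Q R \<longleftrightarrow> P \<noteq> Q \<and> R \<noteq> Q \<and> orthogonal (P - Q) (R - Q)"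

definition hjelmslev_quadrilateral :: "real^2 \<Rightarrow> real^2 \<Rightarrow> real^2 \<Rightarrow> real^2 \<Rightarrow> bool" where
  "hjelmslev_quadrilateral A B C D \<longleftrightarrow>
     (right_angle D A B \<and> right_angle B C D) \<or> (right_angle A B C \<and> right_angle C D A)"

text \<open>The definite descriptions in \<open>circumcenter\<close> and \<open>orthocenter\<close> are meaningful when
  the three points are not collinear.\<close>

definition circumcenter :: "real^2 \<Rightarrow> real^2 \<Rightarrow> real^2 \<Rightarrow> real^2" where
  "circumcenter A B C = (THE P. dist P A = dist P B \<and> dist P B = dist P C)"

definition orthocenter :: "real^2 \<Rightarrow> real^2 \<Rightarrow> real^2 \<Rightarrow> real^2" where
  "orthocenter A B C =
     (THE P. orthogonal (P - A) (B - C) \<and> orthogonal (P - B) (C - A) \<and> orthogonal (P - C) (A - B))"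

definition circumcircle :: "real^2 \<Rightarrow> real^2 \<Rightarrow> real^2 \<Rightarrow> (real^2) set" where
  "circumcircle A B C = sphere (circumcenter A B C) (dist (circumcenter A B C) A)"

definition nine_point_circle :: "real^2 \<Rightarrow> real^2 \<Rightarrow> real^2 \<Rightarrow> (real^2) set" where
  "nine_point_circle A B C = circumcircle (midpoint B C) (midpoint C A) (midpoint A B)"

text \<open>Four points have exactly one such common point unless the nine-point circles coincide
  (orthocentric quadruples) or a component triangle is degenerate; neither happens for
  the vertices of a convex quadrilateral.\<close>

definition poncelet_point :: "real^2 \<Rightarrow> real^2 \<Rightarrow> real^2 \<Rightarrow> real^2 \<Rightarrow> real^2" where
  "poncelet_point A B C D =
     (THE P. P \<in> nine_point_circle B C D \<and> P \<in> nine_point_circle A C D \<and>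
             P \<in> nine_point_circle A B D \<and> P \<in> nine_point_circle A B C)"

text \<open>The reflection of the orthocenter in the circumcenter.\<close>

definition de_longchamps_point :: "real^2 \<Rightarrow> real^2 \<Rightarrow> real^2 \<Rightarrow> real^2" where
  "de_longchamps_point A B C = 2 *\<^sub>R circumcenter A B C - orthocenter A B C"

text \<open>Signed areas are positive for counterclockwise orientation. Taking the orientation of
  a fixed clockwise quadrilateral as positive instead negates all signed areas at once, so
  linear relations between them do not depend on this choice.\<close>

definition signed_area3 :: "real^2 \<Rightarrow> real^2 \<Rightarrow> real^2 \<Rightarrow> real" where
  "signed_area3 X Y Z =
     ((Y - X) $ 1 * (Z - X) $ 2 - (Y - X) $ 2 * (Z - X) $ 1) / 2"

definition signed_area4 :: "real^2 \<Rightarrow> real^2 \<Rightarrow> real^2 \<Rightarrow> real^2 \<Rightarrow> real" where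
  "signed_area4 X Y Z W = signed_area3 X Y Z + signed_area3 Z W X"

end

theory Submission
  imports Defs
begin

text \<open>
  A Hjelmslev quadrilateral is cyclic: by Thales, the diagonal joining the two vertices
  without a prescribed right angle is a diameter of the circumcircle.  For a cyclic
  quadrilateral with circumcenter \<open>O\<close> the nine-point circles have centers
  \<open>E + (O - X) / 2\<close> for \<open>X = A, B, C, D\<close> and a common radius, half the circumradius,
  where \<open>E = (A + B + C + D) / 2 - O\<close> is the anticenter.  Hence \<open>E\<close> is the Poncelet point
  (\<open>poncelet_point_cyclic\<close>).  If, say, the right angles are at \<open>A\<close> and \<open>C\<close>, then \<open>O\<close> is the
  midpoint of \<open>BD\<close>, and therefore \<open>E\<close> is the midpoint of \<open>AC\<close>.

  Take \<open>E\<close> as origin and write \<open>u\<close>, \<open>v\<close>, \<open>w\<close> for the vectors to \<open>A\<close>, \<open>B\<close>, \<open>D\<close>, so that \<open>C\<close> is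
  \<open>- u\<close>.  Since \<open>O\<close> lies on the perpendicular bisector of \<open>AC\<close>, the projections of \<open>v\<close> and \<open>w\<close>
  to the line \<open>AC\<close> are opposite.  The point \<open>X\<^sub>2\<^sub>0\<close> of a triangle is four times the
  circumcenter minus the sum of the vertices; as all four triangles have a side on the line
  \<open>AC\<close>, their de Longchamps points are explicit combinations of \<open>u\<close>, \<open>v\<close>, \<open>w\<close> and the quarter
  turn of \<open>u\<close> (\<open>de_longchamps_point_explicit\<close>).  In the vector product of the diagonals of
  \<open>FGHI\<close> the remaining quotients cancel by Lagrange's identity, which leaves twice the vector
  product of \<open>AC\<close> and \<open>BD\<close> (\<open>de_longchamps_area\<close>).
\<close>

section \<open>Plane vector algebra\<close>

definition cross2 :: "real^2 \<Rightarrow> real^2 \<Rightarrow> real" where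
  "cross2 u v = u $ 1 * v $ 2 - u $ 2 * v $ 1"

definition quarter_turn :: "real^2 \<Rightarrow> real^2" where
  "quarter_turn u = vector [- (u $ 2), u $ 1]"

lemma quarter_turn_nth [simp]:
  "quarter_turn u $ 1 = - (u $ 2)" "quarter_turn u $ 2 = u $ 1"
  by (simp_all add: quarter_turn_def)

lemma inner_real2: "u \<bullet> v = u $ 1 * v $ 1 + u $ 2 * v $ 2" for u v :: "real^2"
  by (simp add: inner_vec_def sum_2)

lemma real2_eq_iff: "u = v \<longleftrightarrow> u $ 1 = v $ 1 \<and> u $ 2 = v $ 2" for u v :: "real^2"
  by (simp add: vec_eq_iff forall_2)

lemma lagrange_identity: "(u \<bullet> u) * (v \<bullet> v) = (u \<bullet> v)\<^sup>2 + (cross2 u v)\<^sup>2"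
  by (simp add: inner_real2 cross2_def power2_eq_square algebra_simps)

lemma signed_area3_cross2: "signed_area3 X Y Z = cross2 (Y - X) (Z - X) / 2"
  by (simp add: signed_area3_def cross2_def)

lemma signed_area3_nonzero:
  assumes "\<not> collinear {X, Y, Z}"
  shows "signed_area3 X Y Z \<noteq> 0"
proof
  assume "signed_area3 X Y Z = 0"
  then have "cross2 (X - Y) (Z - Y) = 0"
    by (simp add: signed_area3_def cross2_def algebra_simps)
  then have "((X - Y) \<bullet> (Z - Y))\<^sup>2 = (norm (X - Y) * norm (Z - Y))\<^sup>2"
    using lagrange_identity[of "X - Y" "Z - Y"]
    by (simp add: power_mult_distrib power2_norm_eq_inner)
  then have "\<bar>(X - Y) \<bullet> (Z - Y)\<bar> = norm (X - Y) * norm (Z - Y)"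
    by (intro power2_eq_imp_eq[of "\<bar>_\<bar>"])
      (simp_all only: power2_abs abs_ge_zero norm_ge_zero mult_nonneg_nonneg)
  then have "collinear {0, X - Y, Z - Y}"
    by (simp add: norm_cauchy_schwarz_equal)
  with assms show False
    by (simp add: collinear_3[of X Y Z])
qed

text \<open>Only the diagonals matter, so a cyclic relabelling of the vertices does no harm.\<close>

lemma signed_area4_diagonals: "signed_area4 X Y Z W = cross2 (Z - X) (W - Y) / 2"
  by (simp add: signed_area4_def signed_area3_def cross2_def field_simps)

lemma signed_area4_rotate: "signed_area4 Y Z W X = signed_area4 X Y Z W"
  by (simp add: signed_area4_diagonals cross2_def field_simps)

lemma orthogonal_to_independent_imp_zero:
  assumes "cross2 u v \<noteq> 0" "x \<bullet> u = 0" "x \<bullet> v = 0"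
  shows "x = 0"
proof -
  \<comment> \<open>Cramer's rule for the two equations.\<close>
  have "cross2 u v * x $ 1 = (x \<bullet> u) * v $ 2 - (x \<bullet> v) * u $ 2"
    and "cross2 u v * x $ 2 = (x \<bullet> v) * u $ 1 - (x \<bullet> u) * v $ 1"
    by (simp_all add: cross2_def inner_real2 algebra_simps)
  with assms show ?thesis
    by (simp add: real2_eq_iff)
qed

section \<open>Circumcenter, orthocenter and de Longchamps point\<close>

lemma dist_eq_iff_inner:
  "dist P X = dist P Y \<longleftrightarrow> 2 * (P \<bullet> (Y - X)) = Y \<bullet> Y - X \<bullet> X" for P :: "real^2"
proof -
  have "dist P X = dist P Y \<longleftrightarrow> (P - X) \<bullet> (P - X) = (P - Y) \<bullet> (P - Y)"
    by (simp add: dist_norm norm_eq)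
  then show ?thesis
    by (simp add: inner_diff_left inner_diff_right inner_commute algebra_simps)
qed

lemma equidistant_unique:
  assumes nz: "signed_area3 A B C \<noteq> 0"
    and P: "dist P A = dist P B" "dist P B = dist P C"
    and Q: "dist Q A = dist Q B" "dist Q B = dist Q C"
  shows "P = Q"
proof -
  have "(P - Q) \<bullet> (B - A) = 0" "(P - Q) \<bullet> (C - A) = 0"
    using P Q dist_eq_iff_inner[of P A B] dist_eq_iff_inner[of Q A B]
      dist_eq_iff_inner[of P A C] dist_eq_iff_inner[of Q A C]
    by (simp_all add: inner_diff_left)
  with nz have "P - Q = 0"
    by (intro orthogonal_to_independent_imp_zero[of "B - A" "C - A"])
      (simp_all add: signed_area3_cross2)
  then show ?thesis by simp
qed

lemma circumcenter_eqI:
  assumes "signed_area3 A B C \<noteq> 0" "dist P A = dist P B" "dist P B = dist P C"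
  shows "circumcenter A B C = P"
  unfolding circumcenter_def
  using assms equidistant_unique[OF assms(1)] by (intro the_equality) blast+

text \<open>With the circumcenter \<open>P\<close> as origin, the orthocenter is the sum of the vertices, because
  \<open>B + C\<close> is orthogonal to \<open>B - C\<close> whenever \<open>B\<close> and \<open>C\<close> have the same length.\<close>

lemma orthocenter_eqI:
  assumes nz: "signed_area3 A B C \<noteq> 0"
    and P: "dist P A = dist P B" "dist P B = dist P C"
  shows "orthocenter A B C = A + B + C - 2 *\<^sub>R P"
  unfolding orthocenter_def
proof (rule the_equality)
  let ?T = "A + B + C - 2 *\<^sub>R P"
  have P': "2 * (P \<bullet> B) - 2 * (P \<bullet> A) = B \<bullet> B - A \<bullet> A"
    "2 * (P \<bullet> C) - 2 * (P \<bullet> B) = C \<bullet> C - B \<bullet> B"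
    using P by (simp_all only: dist_eq_iff_inner inner_diff_right right_diff_distrib)
  show T: "orthogonal (?T - A) (B - C) \<and> orthogonal (?T - B) (C - A)
      \<and> orthogonal (?T - C) (A - B)"
    unfolding orthogonal_def inner_diff_left inner_diff_right inner_add_left inner_scaleR_left
    by (insert P' inner_commute[of B A] inner_commute[of C A] inner_commute[of C B];
        intro conjI; linarith)
  fix Q
  assume Q: "orthogonal (Q - A) (B - C) \<and> orthogonal (Q - B) (C - A)
    \<and> orthogonal (Q - C) (A - B)"
  have "(Q - ?T) \<bullet> (B - A) = 0" "(Q - ?T) \<bullet> (C - A) = 0"
    using Q T by (simp_all only: orthogonal_def inner_diff_left inner_diff_right) linarith+
  with nz have "Q - ?T = 0"
    by (intro orthogonal_to_independent_imp_zero[of "B - A" "C - A"])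
      (simp_all add: signed_area3_cross2)
  then show "Q = ?T" by simp
qed

lemma de_longchamps_point_eqI:
  assumes "signed_area3 A B C \<noteq> 0" "dist P A = dist P B" "dist P B = dist P C"
  shows "de_longchamps_point A B C = 4 *\<^sub>R P - (A + B + C)"
  using circumcenter_eqI[OF assms] orthocenter_eqI[OF assms]
  by (simp add: de_longchamps_point_def real2_eq_iff)

text \<open>The circumcenter of the triangle \<open>E\<close>, \<open>E + u\<close>, \<open>E + v\<close> lies on the perpendicular bisector of
  the side \<open>u\<close>; its position there is determined by the distance to \<open>E + v\<close>.  The formula is
  asymmetric in \<open>u\<close> and \<open>v\<close> on purpose: both orders of the vertices are covered, so that one can
  always let \<open>u\<close> be the side on a common line.\<close>

lemma de_longchamps_point_explicit:
  fixes E u v :: "real^2"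
  assumes nz: "cross2 u v \<noteq> 0"
  defines "L \<equiv> E + u - v + (2 * (v \<bullet> v - u \<bullet> v) / cross2 u v) *\<^sub>R quarter_turn u"
  shows "de_longchamps_point E (E + u) (E + v) = L"
    and "de_longchamps_point E (E + v) (E + u) = L"
proof -
  define k where "k = (v \<bullet> v - u \<bullet> v) / (2 * cross2 u v)"
  define q where "q = u /\<^sub>R 2 + k *\<^sub>R quarter_turn u"
  have "2 * (q \<bullet> u) = u \<bullet> u"
    by (simp add: q_def inner_real2 algebra_simps)
  moreover have "2 * (q \<bullet> v) = u \<bullet> v + 2 * k * cross2 u v"
    by (simp add: q_def inner_real2 cross2_def algebra_simps)
  moreover have "2 * k * cross2 u v = v \<bullet> v - u \<bullet> v"
    using nz by (simp add: k_def)
  ultimately have "2 * (q \<bullet> u) = u \<bullet> u" "2 * (q \<bullet> v) = v \<bullet> v"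
    by simp_all
  then have d: "dist (E + q) E = dist (E + q) (E + u)"
      "dist (E + q) E = dist (E + q) (E + v)"
    using dist_eq_iff_inner[of q 0 u] dist_eq_iff_inner[of q 0 v]
    by (simp_all add: dist_norm)
  have L: "L = 4 *\<^sub>R (E + q) - (E + (E + u) + (E + v))"
    by (simp add: L_def q_def k_def real2_eq_iff)
  have nz': "signed_area3 E (E + u) (E + v) \<noteq> 0" "signed_area3 E (E + v) (E + u) \<noteq> 0"
    using nz by (simp_all add: signed_area3_cross2 cross2_def mult.commute)
  show "de_longchamps_point E (E + u) (E + v) = L"
    using de_longchamps_point_eqI[OF nz'(1)] d L by simp
  show "de_longchamps_point E (E + v) (E + u) = L"
    using de_longchamps_point_eqI[OF nz'(2)] d L by (simp add: add_ac)
qed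

section \<open>The Poncelet point of a cyclic quadrilateral\<close>

text \<open>The vector from the midpoint of a side to the stated center is half the vector from the
  circumcenter to the opposite vertex, so its length is \<open>r / 2\<close> for all three sides.\<close>

lemma nine_point_circle_eq:
  assumes nz: "signed_area3 A B C \<noteq> 0"
    and r: "dist O' A = r" "dist O' B = r" "dist O' C = r"
  shows "nine_point_circle A B C = sphere ((A + B + C - O') /\<^sub>R 2) (r / 2)"
proof -
  let ?N = "(A + B + C - O') /\<^sub>R 2"
  have half: "dist ((Y - O') /\<^sub>R 2) 0 = dist O' Y / 2" for Y
    by (simp add: dist_norm norm_minus_commute)
  have "?N - midpoint B C = (A - O') /\<^sub>R 2" "?N - midpoint C A = (B - O') /\<^sub>R 2"
    "?N - midpoint A B = (C - O') /\<^sub>R 2"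
    by (simp_all add: midpoint_def real2_eq_iff algebra_simps)
  then have d: "dist ?N (midpoint B C) = r / 2" "dist ?N (midpoint C A) = r / 2"
    "dist ?N (midpoint A B) = r / 2"
    using half[of A] half[of B] half[of C] r by (simp_all only: dist_norm diff_zero)
  have "signed_area3 (midpoint B C) (midpoint C A) (midpoint A B) = signed_area3 A B C / 4"
    by (simp add: midpoint_def signed_area3_def field_simps)
  with nz d have "circumcenter (midpoint B C) (midpoint C A) (midpoint A B) = ?N"
    by (intro circumcenter_eqI) simp_all
  with d show ?thesis
    by (simp only: nine_point_circle_def circumcircle_def)
qed

text \<open>A common point \<open>E + W\<close> makes \<open>O - 2W\<close> a point at distance \<open>r\<close> from \<open>A\<close>, \<open>B\<close>, \<open>C\<close>, that is, a
  second circumcenter of the triangle \<open>ABC\<close>; hence \<open>W = 0\<close>.\<close>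

lemma poncelet_point_cyclic:
  assumes nz: "signed_area3 B C D \<noteq> 0" "signed_area3 A C D \<noteq> 0"
      "signed_area3 A B D \<noteq> 0" "signed_area3 A B C \<noteq> 0"
    and r: "dist O' A = r" "dist O' B = r" "dist O' C = r" "dist O' D = r"
  shows "poncelet_point A B C D = (A + B + C + D) /\<^sub>R 2 - O'"
  unfolding poncelet_point_def
proof (rule the_equality)
  define E where "E = (A + B + C + D) /\<^sub>R 2 - O'"
  have on_circle: "P \<in> sphere (E + (O' - X) /\<^sub>R 2) (r / 2)
      \<longleftrightarrow> dist (O' - 2 *\<^sub>R (P - E)) X = r" for P X
  proof -
    have "O' - 2 *\<^sub>R (P - E) - X = 2 *\<^sub>R (E + (O' - X) /\<^sub>R 2 - P)"
      by (simp add: real2_eq_iff algebra_simps)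
    then have "dist (O' - 2 *\<^sub>R (P - E)) X = 2 * dist (E + (O' - X) /\<^sub>R 2) P"
      by (simp add: dist_norm)
    then show ?thesis by auto
  qed
  have centers: "(B + C + D - O') /\<^sub>R 2 = E + (O' - A) /\<^sub>R 2"
    "(A + C + D - O') /\<^sub>R 2 = E + (O' - B) /\<^sub>R 2"
    "(A + B + D - O') /\<^sub>R 2 = E + (O' - C) /\<^sub>R 2"
    "(A + B + C - O') /\<^sub>R 2 = E + (O' - D) /\<^sub>R 2"
    by (simp_all add: E_def real2_eq_iff algebra_simps)
  have circles: "nine_point_circle B C D = sphere (E + (O' - A) /\<^sub>R 2) (r / 2)"
    "nine_point_circle A C D = sphere (E + (O' - B) /\<^sub>R 2) (r / 2)"
    "nine_point_circle A B D = sphere (E + (O' - C) /\<^sub>R 2) (r / 2)"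
    "nine_point_circle A B C = sphere (E + (O' - D) /\<^sub>R 2) (r / 2)"
    using nine_point_circle_eq[OF nz(1) r(2,3,4)] nine_point_circle_eq[OF nz(2) r(1,3,4)]
      nine_point_circle_eq[OF nz(3) r(1,2,4)] nine_point_circle_eq[OF nz(4) r(1,2,3)]
    by (simp_all only: centers)
  show "(A + B + C + D) /\<^sub>R 2 - O' \<in> nine_point_circle B C D
    \<and> (A + B + C + D) /\<^sub>R 2 - O' \<in> nine_point_circle A C D
    \<and> (A + B + C + D) /\<^sub>R 2 - O' \<in> nine_point_circle A B D
    \<and> (A + B + C + D) /\<^sub>R 2 - O' \<in> nine_point_circle A B C"
    unfolding E_def[symmetric] circles on_circle using r by simp
  fix P
  assume "P \<in> nine_point_circle B C D \<and> P \<in> nine_point_circle A C D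
    \<and> P \<in> nine_point_circle A B D \<and> P \<in> nine_point_circle A B C"
  then have "dist (O' - 2 *\<^sub>R (P - E)) A = r" "dist (O' - 2 *\<^sub>R (P - E)) B = r"
    "dist (O' - 2 *\<^sub>R (P - E)) C = r"
    unfolding circles on_circle by simp_all
  with r have "O' - 2 *\<^sub>R (P - E) = O'"
    by (intro equidistant_unique[OF nz(4)]) simp_all
  then show "P = (A + B + C + D) /\<^sub>R 2 - O'"
    by (simp add: E_def)
qed

lemma thales:
  assumes "right_angle P Q R"
  shows "dist (midpoint P R) Q = dist (midpoint P R) P"
    and "dist (midpoint P R) R = dist (midpoint P R) P"
proof -
  have "(P - Q) \<bullet> (R - Q) = 0"
    using assms by (simp add: right_angle_def orthogonal_def)
  then show "dist (midpoint P R) Q = dist (midpoint P R) P"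
    by (simp add: dist_eq_iff_inner midpoint_def inner_real2 field_simps)
  show "dist (midpoint P R) R = dist (midpoint P R) P"
    by (simp add: dist_midpoint)
qed

section \<open>The area relation\<close>

text \<open>Right angles at \<open>A\<close> and \<open>C\<close> make the midpoint of \<open>BD\<close> equidistant from \<open>A\<close> and \<open>C\<close>.
  Seen from \<open>E\<close>, the vectors to \<open>B\<close> and \<open>D\<close> then have opposite inner products \<open>t\<close> and \<open>- t\<close> with
  the vector to \<open>A\<close>.  This makes Lagrange's identity produce the same number \<open>t\<^sup>2\<close> on both sides
  of \<open>AC\<close>, so that each quotient collapses to the vector product in its denominator.\<close>

lemma de_longchamps_area:
  assumes nz: "signed_area3 A B C \<noteq> 0" "signed_area3 C D A \<noteq> 0"
    and equidistant: "dist (midpoint B D) A = dist (midpoint B D) C"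
  defines "E \<equiv> midpoint A C"
  shows "signed_area4 A B C D = 1 / 2 * signed_area4 (de_longchamps_point E A B)
    (de_longchamps_point E B C) (de_longchamps_point E C D) (de_longchamps_point E D A)"
proof -
  define u v w where "u = A - E" and "v = B - E" and "w = D - E"
  define t b d J where "t = u \<bullet> v" and "b = cross2 u v" and "d = cross2 u w"
    and "J = quarter_turn u"
  have vertices: "A = E + u" "B = E + v" "C = E + - u" "D = E + w"
    by (simp_all add: u_def v_def w_def E_def midpoint_def real2_eq_iff field_simps)
  have uw: "u \<bullet> w = - t"
    using equidistant unfolding dist_eq_iff_inner vertices t_def
    by (simp add: midpoint_def inner_real2 field_simps)
  have "signed_area3 A B C = b" "signed_area3 C D A = - d"
    unfolding vertices by (simp_all add: signed_area3_def b_def d_def cross2_def field_simps)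
  with nz have b0: "b \<noteq> 0" and d0: "d \<noteq> 0" by simp_all
  have neg: "cross2 (- u) x = - cross2 u x" "quarter_turn (- u) = - J" for x
    by (simp_all add: cross2_def J_def real2_eq_iff)
  have F: "de_longchamps_point E A B = E + u - v + (2 * (v \<bullet> v - t) / b) *\<^sub>R J"
    using de_longchamps_point_explicit(1)[of u v E] b0
    by (simp add: vertices(1,2)[symmetric] t_def b_def J_def)
  have G: "de_longchamps_point E B C = E - u - v + (2 * (v \<bullet> v + t) / b) *\<^sub>R J"
    using de_longchamps_point_explicit(2)[of "- u" v E] b0
    by (simp only: vertices(2,3)[symmetric] neg)
      (simp add: vertices(3) t_def b_def)
  have H: "de_longchamps_point E C D = E - u - w + (2 * (w \<bullet> w - t) / d) *\<^sub>R J"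
    using de_longchamps_point_explicit(1)[of "- u" w E] d0
    by (simp only: vertices(3,4)[symmetric] neg)
      (simp add: vertices(3) uw d_def)
  have I: "de_longchamps_point E D A = E + u - w + (2 * (w \<bullet> w + t) / d) *\<^sub>R J"
    using de_longchamps_point_explicit(2)[of u w E] d0
    by (simp add: vertices(1,4)[symmetric] uw d_def J_def)
  define \<alpha> where "\<alpha> = (w \<bullet> w - t) / d - (v \<bullet> v - t) / b"
  define \<beta> where "\<beta> = (w \<bullet> w + t) / d - (v \<bullet> v + t) / b"
  have diagonals:
    "de_longchamps_point E C D - de_longchamps_point E A B
      = (2 * \<alpha>) *\<^sub>R J - 2 *\<^sub>R u - (w - v)"
    "de_longchamps_point E D A - de_longchamps_point E B C
      = (2 * \<beta>) *\<^sub>R J + 2 *\<^sub>R u - (w - v)"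
    unfolding F G H I \<alpha>_def \<beta>_def
    by (simp_all add: real2_eq_iff algebra_simps add_divide_distrib diff_divide_distrib)
  have "cross2 ((2 * \<alpha>) *\<^sub>R J - 2 *\<^sub>R u - (w - v)) ((2 * \<beta>) *\<^sub>R J + 2 *\<^sub>R u - (w - v))
      = 4 * (d - b) - 4 * (u \<bullet> u) * (\<alpha> + \<beta>) + 2 * (\<alpha> - \<beta>) * (u \<bullet> w - u \<bullet> v)"
    by (simp add: J_def b_def d_def cross2_def inner_real2 algebra_simps)
  also have "\<dots> = 4 * (d - b) - 4 * ((u \<bullet> u) * (\<alpha> + \<beta>) + t * (\<alpha> - \<beta>))"
    by (simp add: uw t_def algebra_simps)
  also have "(u \<bullet> u) * (\<alpha> + \<beta>) + t * (\<alpha> - \<beta>)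
      = 2 * (((u \<bullet> u) * (w \<bullet> w) - t\<^sup>2) / d - ((u \<bullet> u) * (v \<bullet> v) - t\<^sup>2) / b)"
    using b0 d0 by (simp add: \<alpha>_def \<beta>_def field_simps power2_eq_square)
  also have "\<dots> = 2 * (d - b)"
  proof -
    have "(u \<bullet> u) * (w \<bullet> w) - t\<^sup>2 = d * d" "(u \<bullet> u) * (v \<bullet> v) - t\<^sup>2 = b * b"
      using lagrange_identity[of u w] lagrange_identity[of u v]
      by (simp_all add: uw b_def d_def t_def power2_eq_square)
    then show ?thesis using b0 d0 by simp
  qed
  also have "4 * (d - b) - 4 * (2 * (d - b)) = 2 * cross2 (C - A) (D - B)"
    unfolding vertices by (simp add: b_def d_def cross2_def algebra_simps)
  finally show ?thesis
    unfolding signed_area4_diagonals diagonals by simp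
qed

text \<open>The Poncelet point is located for two readings of the same quadrilateral, because the right
  angles may be at the first and third or at the second and fourth vertex of the given one.\<close>

lemma hjelmslev_area:
  assumes nz: "signed_area3 A B C \<noteq> 0" "signed_area3 B C D \<noteq> 0"
      "signed_area3 C D A \<noteq> 0" "signed_area3 D A B \<noteq> 0"
    and right: "right_angle D A B" "right_angle B C D"
  shows "poncelet_point A B C D = midpoint A C" "poncelet_point B C D A = midpoint A C"
    and "E = midpoint A C \<Longrightarrow>
      signed_area4 A B C D = 1 / 2 * signed_area4 (de_longchamps_point E A B)
        (de_longchamps_point E B C) (de_longchamps_point E C D) (de_longchamps_point E D A)"
proof -
  define r where "r = dist (midpoint B D) B"
  have r: "dist (midpoint B D) A = r" "dist (midpoint B D) B = r"
    "dist (midpoint B D) C = r" "dist (midpoint B D) D = r"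
    using thales[OF right(1)] thales[OF right(2)]
    by (simp_all add: r_def midpoint_sym)
  have nz': "signed_area3 A C D \<noteq> 0" "signed_area3 A B D \<noteq> 0"
    "signed_area3 B D A \<noteq> 0" "signed_area3 B C A \<noteq> 0"
    using nz by (simp_all add: signed_area3_def algebra_simps)
  show "poncelet_point A B C D = midpoint A C"
    using poncelet_point_cyclic[OF nz(2) nz'(1,2) nz(1) r]
    by (simp add: midpoint_def real2_eq_iff field_simps)
  show "poncelet_point B C D A = midpoint A C"
    using poncelet_point_cyclic[OF nz(3) nz'(3,4) nz(2) r(2,3,4,1)]
    by (simp add: midpoint_def real2_eq_iff field_simps)
  show "signed_area4 A B C D = 1 / 2 * signed_area4 (de_longchamps_point E A B)
        (de_longchamps_point E B C) (de_longchamps_point E C D) (de_longchamps_point E D A)"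
    if "E = midpoint A C"
    unfolding that using nz(1,3) r by (intro de_longchamps_area) simp_all
qed

theorem theorem8p6:
  fixes A B C D E F G H I :: "real^2"
  assumes "convex_quadrilateral A B C D"
    and "hjelmslev_quadrilateral A B C D"
    and "E = poncelet_point A B C D"
    and "F = de_longchamps_point E A B"
    and "G = de_longchamps_point E B C"
    and "H = de_longchamps_point E C D"
    and "I = de_longchamps_point E D A"
  shows "signed_area4 A B C D = 1 / 2 * signed_area4 F G H I"
proof -
  have nz: "signed_area3 A B C \<noteq> 0" "signed_area3 B C D \<noteq> 0"
    "signed_area3 C D A \<noteq> 0" "signed_area3 D A B \<noteq> 0"
    using assms(1) by (auto simp: convex_quadrilateral_def intro!: signed_area3_nonzero)
  consider "right_angle D A B" "right_angle B C D" | "right_angle A B C" "right_angle C D A"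
    using assms(2) by (auto simp: hjelmslev_quadrilateral_def)
  then show ?thesis
  proof cases
    case 1
    then show ?thesis
      using hjelmslev_area(1,3)[OF nz] assms(3-7) by simp
  next
    case 2
    \<comment> \<open>The same configuration with the vertices read as \<open>D, A, B, C\<close>.\<close>
    have "E = midpoint D B"
      using hjelmslev_area(2)[OF nz(4,1,2,3)] 2 assms(3) by simp
    then have "signed_area4 D A B C = 1 / 2 * signed_area4 I F G H"
      using hjelmslev_area(3)[OF nz(4,1,2,3), of E] 2 assms(4-7) by simp
    then show ?thesis
      by (simp only: signed_area4_rotate[of A B C D] signed_area4_rotate[of F G H I])
  qed
qed

end
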